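(* Let $\mathcal{A}$ be a $C^*$-algebra with unit $1$, let $n\ge 2$, and let $P_1,\dots,P_n$ be non-trivial projections in $\mathcal{A}$. Then $(P_1,\dots,P_n)$ is complete in $\mathcal{A}$ if and only if $A=\sum_{i=1}^nP_i$ is invertible in $\mathcal{A}$ and $$\|P_iA^{-1}P_j\|<\big[(n-1)\|A^{-1}\|\,\|A\|^2\big]^{-1}\quad\text{for all } i\ne j,\ i,j=1,\dots,n.$$
   Context: A projection in $\mathcal{A}$ is an element $P$ with $P=P^*=P^2$; it is non-trivial if $P\ne 0$ and $P\neq 1$. An $n$-tuple $(P_1,\dots,P_n)$ of non-trivial projections in $\mathcal{A}$ is called complete in $\mathcal{A}$ if $\mathcal{A}$ is the linear (algebraic) direct sum of the subspaces $P_i\mathcal{A}=\{P_ix : x\in\mathcal{A}\}$, $i=1,\dots,n$, i.e. every element of $\mathcal{A}$ is uniquely a sum $x_1+\cdots+x_n$ with $x_i\in P_i\mathcal{A}$. *)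

theory Defs
  imports "HOL-Analysis.Analysis"
begin

text \<open>
  Unital complex C*-algebras. The underlying real Banach algebra comes from the library classes;
  \<open>cscale\<close> extends its real scalar multiplication to complex scalars. The axiom
  \<^term>\<open>norm 1 = 1\<close> inherited from \<^class>\<open>real_normed_algebra_1\<close> follows from the C*-identity
  in every nonzero algebra, so the class only leaves out the zero algebra, which has no
  non-trivial projection.
\<close>

class unital_cstar_algebra = real_normed_algebra_1 + banach +
  fixes cscale :: "complex \<Rightarrow> 'a \<Rightarrow> 'a"
    and adj :: "'a \<Rightarrow> 'a"
  assumes cscale_add_right: "cscale c (x + y) = cscale c x + cscale c y"
    and cscale_add_left: "cscale (c + d) x = cscale c x + cscale d x"
    and cscale_cscale: "cscale c (cscale d x) = cscale (c * d) x"
    and cscale_of_real: "cscale (complex_of_real r) x = r *\<^sub>R x"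
    and cscale_mult_left: "cscale c x * y = cscale c (x * y)"
    and cscale_mult_right: "x * cscale c y = cscale c (x * y)"
    and norm_cscale: "norm (cscale c x) = cmod c * norm x"
    and adj_adj: "adj (adj x) = x"
    and adj_add: "adj (x + y) = adj x + adj y"
    and adj_cscale: "adj (cscale c x) = cscale (cnj c) (adj x)"
    and adj_mult: "adj (x * y) = adj y * adj x"
    and cstar_identity: "norm (adj x * x) = (norm x)\<^sup>2"

definition projection :: "'a::unital_cstar_algebra \<Rightarrow> bool" where
  "projection p \<longleftrightarrow> p = adj p \<and> p = p * p"

definition nontrivial_projection :: "'a::unital_cstar_algebra \<Rightarrow> bool" where
  "nontrivial_projection p \<longleftrightarrow> projection p \<and> p \<noteq> 0 \<and> p \<noteq> 1"

text \<open>
  The tuple \<open>(P\<^sub>1, \<dots>, P\<^sub>n)\<close> is the restriction of \<open>P\<close> to \<open>{1..n}\<close>. Families of summands are taken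
  in the extensional product \<open>\<Pi>\<^sub>E\<close>, so that values outside \<open>{1..n}\<close> do not disturb uniqueness.
\<close>

definition complete_projections :: "nat \<Rightarrow> (nat \<Rightarrow> 'a::unital_cstar_algebra) \<Rightarrow> bool" where
  "complete_projections n P \<longleftrightarrow>
     (\<forall>i\<in>{1..n}. nontrivial_projection (P i)) \<and>
     (\<forall>a. \<exists>!x. x \<in> (\<Pi>\<^sub>E i\<in>{1..n}. {P i * y | y. True}) \<and> a = (\<Sum>i=1..n. x i))"

definition is_alg_inverse :: "'a::monoid_mult \<Rightarrow> 'a \<Rightarrow> bool" where
  "is_alg_inverse a b \<longleftrightarrow> a * b = 1 \<and> b * a = 1"

definition alg_invertible :: "'a::monoid_mult \<Rightarrow> bool" where
  "alg_invertible a \<longleftrightarrow> (\<exists>b. is_alg_inverse a b)"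

text \<open>
  The class \<^class>\<open>inverse\<close> is not available on a general C*-algebra. The inverse is unique if it
  exists, and \<open>alg_inverse a\<close> is unspecified if \<open>a\<close> is not invertible.
\<close>

definition alg_inverse :: "'a::monoid_mult \<Rightarrow> 'a" where
  "alg_inverse a = (THE b. is_alg_inverse a b)"

end

theory Submission imports Defs begin

text \<open>
  If the tuple is complete, the components \<open>E\<^sub>i\<close> of \<open>1\<close> satisfy \<open>E\<^sub>i P\<^sub>j = \<delta>\<^sub>i\<^sub>j P\<^sub>j\<close>, hence
  \<open>A\<^sup>-\<^sup>1 = \<Sum> E\<^sub>i\<^sup>* E\<^sub>i\<close> and \<open>P\<^sub>i A\<^sup>-\<^sup>1 P\<^sub>j = 0\<close> for \<open>i \<noteq> j\<close>.
  Conversely, \<open>a = \<Sum> P\<^sub>i A\<^sup>-\<^sup>1 a\<close> always decomposes \<open>a\<close>. Each \<open>2 P\<^sub>i - 1\<close> is a self-adjoint unitary,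
  so \<open>\<parallel>n/2 - A\<parallel> \<le> n/2\<close> and the binomial series gives a self-adjoint square root of \<open>A\<close>. With it,
  \<open>\<parallel>z\<parallel>\<^sup>2 \<le> \<parallel>A\<parallel> \<parallel>z\<^sup>* A\<^sup>-\<^sup>1 z\<parallel>\<close>, so \<open>P\<^sub>i A\<^sup>-\<^sup>1 P\<^sub>i\<close> is bounded below on \<open>P\<^sub>i\<A>\<close> by \<open>\<parallel>A\<parallel>\<^sup>-\<^sup>1\<close>. The
  matrix \<open>(P\<^sub>i A\<^sup>-\<^sup>1 P\<^sub>j)\<close> is then diagonally dominant, which forces a vanishing sum \<open>\<Sum> z\<^sub>i\<close> with
  \<open>z\<^sub>i \<in> P\<^sub>i\<A>\<close> to have all \<open>z\<^sub>i = 0\<close>.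
\<close>

section \<open>Real linearity and isometry of the involution\<close>

lemma adj_scaleR: "adj (r *\<^sub>R x) = r *\<^sub>R adj (x::'a::unital_cstar_algebra)"
  using adj_cscale[of "complex_of_real r" x] by (simp add: cscale_of_real)

lemma adj_zero [simp]: "adj (0::'a::unital_cstar_algebra) = 0"
  using adj_scaleR[of 0 "0::'a"] by simp

lemma adj_one [simp]: "adj (1::'a::unital_cstar_algebra) = 1"
  by (metis adj_adj adj_mult mult_1_left)

lemma adj_sum: "adj (sum f I) = (\<Sum>i\<in>I. adj (f i :: 'a::unital_cstar_algebra))"
  by (induction I rule: infinite_finite_induct) (simp_all add: adj_add)

lemma adj_diff: "adj (x - y) = adj x - adj (y::'a::unital_cstar_algebra)"
  by (metis adj_add add_diff_cancel diff_add_cancel)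

lemma adj_power: "adj (x ^ k) = adj (x::'a::unital_cstar_algebra) ^ k"
  by (induction k) (simp_all add: adj_mult power_commutes)

text \<open>One factor \<open>norm x\<close> cancels in the C*-identity; used for both
  \<open>x\<close> and \<open>adj x\<close>, this makes the involution isometric.\<close>

lemma norm_adj_le: "norm x \<le> norm (adj (x::'a::unital_cstar_algebra))"
proof (cases "x = 0")
  case False
  have "norm x * norm x \<le> norm (adj x) * norm x"
    using norm_mult_ineq[of "adj x" x] cstar_identity[of x] by (simp add: power2_eq_square)
  with False show ?thesis by simp
qed simp

lemma norm_adj [simp]: "norm (adj x) = norm (x::'a::unital_cstar_algebra)"
  using norm_adj_le[of x] norm_adj_le[of "adj x"] by (simp add: adj_adj)

lemma bounded_linear_adj: "bounded_linear (adj :: 'a \<Rightarrow> 'a::unital_cstar_algebra)"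
  by (rule bounded_linear_intro[where K = 1]) (simp_all add: adj_add adj_scaleR)

section \<open>Self-adjoint square roots by the binomial series\<close>

lemma norm_projection_half_le:
  fixes p :: "'a::unital_cstar_algebra"
  assumes "projection p"
  shows "norm ((1/2) *\<^sub>R 1 - p) \<le> 1/2"
proof -
  let ?u = "(1/2) *\<^sub>R 1 - p"
  have p: "adj p = p" "p * p = p" using assms by (simp_all add: projection_def)
  have "adj ?u * ?u = (1/4) *\<^sub>R 1"
    by (simp add: adj_diff adj_scaleR p algebra_simps flip: scaleR_add_left)
  then have "norm (adj ?u * ?u) = (1/2)\<^sup>2" by (simp add: power2_eq_square)
  then have "(norm ?u)\<^sup>2 = (1/2)\<^sup>2" by (simp only: cstar_identity)
  then show ?thesis
    by (metis norm_ge_zero order_refl power2_eq_imp_eq zero_le_divide_1_iff zero_le_numeral)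
qed

text \<open>These are the coefficients of \<open>(1 - t)\<close> to the power 1/2. All but the
  zeroth are nonpositive while the partial sums stay nonnegative, so the absolute values after the
  zeroth add up to at most 1.\<close>

lemma summable_gbinomial_half: "summable (\<lambda>k. \<bar>(-1)^k * ((1/2::real) gchoose k)\<bar>)"
proof -
  let ?c = "\<lambda>k. (-1)^k * ((1/2::real) gchoose k)"
  \<comment> \<open>Summing coefficients amounts to dividing by \<open>1 - t\<close>, which leaves
    the coefficients of \<open>(1 - t)\<close> to the power -1/2.\<close>
  have partial: "sum ?c {..m} = (-1)^m * ((-(1/2)::real) gchoose m)" for m
    using gbinomial_sum_lower_neg[of "1/2::real" m] by (simp add: mult.commute)
  have pos: "(-1)^m * ((-(1/2)::real) gchoose m) \<ge> 0" for m
    by (simp add: gbinomial_pochhammer pochhammer_nonneg flip: power_mult_distrib mult.assoc)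
  have neg: "?c (Suc k) \<le> 0" for k
  proof -
    have "?c (Suc k) = pochhammer (-(1/2)) (Suc k) / fact (Suc k)"
      by (simp only: gbinomial_pochhammer mult.assoc[symmetric] times_divide_eq_right
          power_mult_distrib[symmetric]) simp
    also have "pochhammer (-(1/2)::real) (Suc k) = - (1/2) * pochhammer (1/2) k"
      by (simp add: pochhammer_rec)
    also have "- (1/2) * pochhammer (1/2::real) k / fact (Suc k) \<le> 0"
      by (intro divide_nonpos_nonneg mult_nonpos_nonneg pochhammer_nonneg) simp_all
    finally show ?thesis .
  qed
  have "summable (\<lambda>k. \<bar>?c (Suc k)\<bar>)"
  proof (rule bounded_imp_summable[where B = 1])
    fix m
    have "(\<Sum>k\<le>m. \<bar>?c (Suc k)\<bar>) = - (\<Sum>k\<le>m. ?c (Suc k))"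
      using neg by (simp only: abs_of_nonpos sum_negf)
    also have "\<dots> = 1 - sum ?c {..Suc m}"
      by (subst sum.atMost_Suc_shift) simp
    also have "\<dots> \<le> 1" using partial[of "Suc m"] pos[of "Suc m"] by simp
    finally show "(\<Sum>k\<le>m. \<bar>?c (Suc k)\<bar>) \<le> 1" .
  qed simp
  then show ?thesis using summable_Suc_iff[of "\<lambda>k. \<bar>?c k\<bar>"] by simp
qed

text \<open>Absolute summability of the coefficients lets the series converge even at norm 1, and
  real coefficients keep its sum self-adjoint.\<close>

lemma self_adjoint_sqrt_one_minus:
  fixes x :: "'a::unital_cstar_algebra"
  assumes "norm x \<le> 1" "adj x = x"
  obtains s where "adj s = s" "s * s = 1 - x"
proof -
  define c where "c k = (-1)^k * ((1/2::real) gchoose k)" for k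
  define f where "f k = c k *\<^sub>R x ^ k" for k
  have "norm (f k) \<le> \<bar>c k\<bar>" for k
  proof -
    have "norm (x ^ k) \<le> 1"
      using norm_power_ineq[of x k] power_le_one[of "norm x" k] assms(1) by simp
    then show ?thesis by (simp add: f_def mult_left_le)
  qed
  moreover have "summable (\<lambda>k. \<bar>c k\<bar>)"
    unfolding c_def by (rule summable_gbinomial_half)
  ultimately have sumn: "summable (\<lambda>k. norm (f k))"
    by - (rule summable_comparison_test'[where N = 0], assumption, simp)
  \<comment> \<open>Vandermonde with 1/2 + 1/2 = 1: the squared series has the coefficients of
    \<open>1 - t\<close>, so it stops after two terms.\<close>
  have conv: "(\<Sum>i\<le>k. c i * c (k - i)) = (-1)^k * ((1::real) gchoose k)" for k
  proof -
    have "(\<Sum>i\<le>k. c i * c (k - i)) =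
        (\<Sum>i\<le>k. (-1)^k * (((1/2) gchoose i) * ((1/2) gchoose (k - i))))"
    proof (rule sum.cong)
      fix i assume "i \<in> {..k}"
      then have "(-1::real)^i * (-1)^(k - i) = (-1)^k" by (simp flip: power_add)
      then show "c i * c (k - i) = (-1)^k * (((1/2) gchoose i) * ((1/2) gchoose (k - i)))"
        unfolding c_def by (metis mult.assoc mult.left_commute)
    qed simp
    also have "\<dots> = (-1)^k * ((1/2 + 1/2) gchoose k)"
      by (simp only: gbinomial_Vandermonde[symmetric] sum_distrib_left atLeast0AtMost)
    finally show ?thesis by simp
  qed
  have "(\<Sum>i\<le>k. f i * f (k - i)) = ((-1)^k * ((1::real) gchoose k)) *\<^sub>R x ^ k" for k
    unfolding conv[symmetric] scaleR_sum_left
    by (rule sum.cong) (simp_all add: f_def flip: power_add)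
  then have "(\<lambda>k. ((-1)^k * ((1::real) gchoose k)) *\<^sub>R x ^ k) sums (suminf f * suminf f)"
    using Cauchy_product_sums[OF sumn sumn] by simp
  moreover have "(\<lambda>k. ((-1)^k * ((1::real) gchoose k)) *\<^sub>R x ^ k) sums
      (\<Sum>k\<in>{..<2}. ((-1)^k * ((1::real) gchoose k)) *\<^sub>R x ^ k)"
  proof (rule sums_finite)
    fix k :: nat assume "k \<notin> {..<2}"
    then have "k > 1" by simp
    then have "(1::real) gchoose k = 0"
      using binomial_gbinomial[of 1 k, where 'a = real] by (simp add: binomial_eq_0)
    then show "((-1)^k * ((1::real) gchoose k)) *\<^sub>R x ^ k = 0" by simp
  qed simp
  ultimately have sq: "suminf f * suminf f = 1 - x"
    using sums_unique2 by (fastforce simp: numeral_2_eq_2)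
  have "adj (suminf f) = (\<Sum>k. adj (f k))"
    using bounded_linear.suminf[OF bounded_linear_adj summable_norm_cancel[OF sumn]] by simp
  also have "\<dots> = suminf f" by (rule suminf_cong) (simp add: f_def adj_scaleR adj_power assms(2))
  finally show thesis using sq that by blast
qed

lemma self_adjoint_sqrt_sum_projections:
  fixes P :: "'i \<Rightarrow> 'a::unital_cstar_algebra"
  assumes "\<And>i. i \<in> I \<Longrightarrow> projection (P i)"
  obtains s where "adj s = s" "s * s = sum P I"
\<comment> \<open>This case covers empty and infinite \<open>I\<close>; the sum is 0 in
  both.\<close>
proof (cases "card I = 0")
  case True
  then have "sum P I = 0" by (metis card_eq_0_iff sum.empty sum.infinite)
  then show thesis using that[of 0] by simp
next
  case False
  \<comment> \<open>Each projection is within 1/2 of one half, so the sum is within \<open>r\<close>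
    of \<open>r\<close>. Hence it equals \<open>r\<close> times \<open>1 - x\<close> with
    \<open>norm x \<le> 1\<close>.\<close>
  define r where "r = real (card I) / 2"
  have r: "r > 0" using False by (simp add: r_def)
  define x where "x = 1 - (1/r) *\<^sub>R sum P I"
  have "r *\<^sub>R x = (\<Sum>i\<in>I. (1/2) *\<^sub>R 1 - P i)"
    using r by (simp add: x_def scaleR_diff_right sum_subtractf sum_constant_scaleR del: sum_constant)
      (simp add: r_def)
  then have "r * norm x = norm (\<Sum>i\<in>I. (1/2) *\<^sub>R 1 - P i)"
    using r by (metis abs_of_pos norm_scaleR)
  also have "\<dots> \<le> (\<Sum>i\<in>I. 1/2)"
    by (intro sum_norm_le norm_projection_half_le assms)
  also have "\<dots> = r * 1" by (simp add: r_def)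
  finally have "norm x \<le> 1" using r by (simp only: mult_le_cancel_left_pos)
  moreover have "adj x = x"
  proof -
    have "adj (sum P I) = sum P I"
      unfolding adj_sum using assms by (intro sum.cong) (auto simp: projection_def)
    then show ?thesis by (simp add: x_def adj_diff adj_scaleR)
  qed
  ultimately obtain s where s: "adj s = s" "s * s = 1 - x"
    by (rule self_adjoint_sqrt_one_minus)
  show thesis
  proof (rule that)
    show "adj (sqrt r *\<^sub>R s) = sqrt r *\<^sub>R s" by (simp add: adj_scaleR s)
    show "sqrt r *\<^sub>R s * (sqrt r *\<^sub>R s) = sum P I"
      using r by (simp add: s x_def)
  qed
qed

section \<open>Inverses and a lower bound for their quadratic forms\<close>

lemma is_alg_inverse_unique:
  assumes "is_alg_inverse a b" "is_alg_inverse a c"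
  shows "b = c"
  using assms unfolding is_alg_inverse_def by (metis mult.assoc mult_1_left mult_1_right)

lemma alg_inverse_eq: "is_alg_inverse a b \<Longrightarrow> alg_inverse a = b"
  unfolding alg_inverse_def using is_alg_inverse_unique by blast

text \<open>\<open>t = s * b\<close> is a self-adjoint square root of \<open>b\<close> and inverts
  \<open>s\<close>. Thus \<open>z = s * (t * z)\<close>, and the C*-identity turns the squared norms
  of \<open>s\<close> and \<open>t * z\<close> into the two factors on the right.\<close>

lemma norm_square_le_inverse_form:
  fixes s b z :: "'a::unital_cstar_algebra"
  assumes s: "adj s = s" and b: "is_alg_inverse (s * s) b"
  shows "(norm z)\<^sup>2 \<le> norm (s * s) * norm (adj z * b * z)"
proof -
  have b1: "s * s * b = 1" and b2: "b * (s * s) = 1" using b by (simp_all add: is_alg_inverse_def)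
  define t where "t = s * b"
  \<comment> \<open>Insert \<open>s * s * b = 1\<close> on the right of \<open>b * s\<close>, then
    cancel \<open>b * (s * s)\<close>.\<close>
  have comm: "b * s = s * b"
    by (metis b1 b2 mult.assoc mult_1_left mult_1_right)
  have "adj b = b"
    using is_alg_inverse_unique[OF _ b, of "adj b"] b1 b2 adj_mult[of "s * s" b] adj_mult[of b "s * s"]
    by (simp add: is_alg_inverse_def adj_mult s)
  then have t: "adj t = t" by (simp add: t_def adj_mult s comm)
  have "t * t = s * (b * s) * b" by (simp add: t_def mult.assoc)
  also have "\<dots> = b" using b1 by (simp add: comm mult.assoc)
  finally have tt: "t * t = b" .
  have "s * t = 1" using b1 by (simp add: t_def mult.assoc)
  then have "norm z \<le> norm s * norm (t * z)"
    by (metis mult.assoc mult_1_left norm_mult_ineq)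
  then have "(norm z)\<^sup>2 \<le> (norm s)\<^sup>2 * (norm (t * z))\<^sup>2"
    by (metis norm_ge_zero power_mono power_mult_distrib)
  also have "(norm s)\<^sup>2 = norm (s * s)" using cstar_identity[of s] by (simp add: s)
  also have "(norm (t * z))\<^sup>2 = norm (adj z * b * z)"
    using cstar_identity[of "t * z"] by (simp add: adj_mult t mult.assoc flip: tt)
  finally show ?thesis .
qed

section \<open>From completeness to the inverse of the sum\<close>

lemma complete_imp_dual_idempotents:
  assumes "complete_projections n P"
  obtains E where "(\<Sum>i=1..n. E i) = 1" "\<And>i. i \<in> {1..n} \<Longrightarrow> P i * E i = E i"
    "\<And>i j. i \<in> {1..n} \<Longrightarrow> j \<in> {1..n} \<Longrightarrow> E i * P j = (if i = j then P j else 0)"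
proof -
  let ?X = "\<Pi>\<^sub>E i\<in>{1..n}. {P i * y | y. True}"
  have ex: "\<exists>x. x \<in> ?X \<and> a = (\<Sum>i=1..n. x i)"
    and uniq: "x \<in> ?X \<Longrightarrow> y \<in> ?X \<Longrightarrow> (\<Sum>i=1..n. x i) = (\<Sum>i=1..n. y i) \<Longrightarrow> x = y" for a x y
    using assms unfolding complete_projections_def by metis+
  have idem: "P i * P i = P i" if "i \<in> {1..n}" for i
    using assms that
    by (auto simp: complete_projections_def nontrivial_projection_def projection_def)
  obtain E where EX: "E \<in> ?X" and E1: "1 = (\<Sum>i=1..n. E i)" using ex by blast
  show thesis
  proof (rule that)
    show "(\<Sum>i=1..n. E i) = 1" using E1 by simp
  next
    fix i assume i: "i \<in> {1..n}"
    then obtain y where "E i = P i * y" using EX by fastforce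
    then show "P i * E i = E i" using idem[OF i] by (simp flip: mult.assoc)
  next
    fix i j assume i: "i \<in> {1..n}" and j: "j \<in> {1..n}"
    let ?x = "restrict (\<lambda>i. E i * P j) {1..n}"
    let ?y = "restrict (\<lambda>i. if i = j then P j else 0) {1..n}"
    \<comment> \<open>Both families decompose \<open>P j\<close>: one is the decomposition of 1
      multiplied by \<open>P j\<close> on the right, the other has the single term
      \<open>P j\<close>.\<close>
    have "?x = ?y"
    proof (rule uniq)
      show "?x \<in> ?X"
      proof (rule restrict_PiE_iff[THEN iffD2], rule ballI)
        fix k assume "k \<in> {1..n}"
        then obtain y where "E k = P k * y" using EX by fastforce
        then have "E k * P j = P k * (y * P j)" by (simp add: mult.assoc)
        then show "E k * P j \<in> {P k * y |y. True}" by blast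
      qed
      show "?y \<in> ?X"
      proof (rule restrict_PiE_iff[THEN iffD2], rule ballI)
        fix k
        have "(if k = j then P j else 0) = P k * (if k = j then 1 else 0)" by simp
        then show "(if k = j then P j else 0) \<in> {P k * y |y. True}" by blast
      qed
      have "(\<Sum>i=1..n. ?x i) = (\<Sum>i=1..n. E i) * P j"
        unfolding sum_distrib_right by (rule sum.cong) simp_all
      also have "\<dots> = P j" by (simp only: E1[symmetric] mult_1_left)
      also have "\<dots> = (\<Sum>i=1..n. ?y i)" using j by (simp add: sum.delta)
      finally show "(\<Sum>i=1..n. ?x i) = (\<Sum>i=1..n. ?y i)" .
    qed
    then have "?x i = ?y i" by simp
    then show "E i * P j = (if i = j then P j else 0)" using i by simp
  qed
qed

lemma complete_imp_inverse_sum: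
  fixes P :: "nat \<Rightarrow> 'a::unital_cstar_algebra"
  assumes compl: "complete_projections n P"
  obtains B where "is_alg_inverse (\<Sum>i=1..n. P i) B"
    "\<And>i j. i \<in> {1..n} \<Longrightarrow> j \<in> {1..n} \<Longrightarrow> i \<noteq> j \<Longrightarrow> P i * B * P j = 0"
proof -
  obtain E where E1: "(\<Sum>i=1..n. E i) = 1" and PE: "\<And>i. i \<in> {1..n} \<Longrightarrow> P i * E i = E i"
    and EP: "\<And>i j. i \<in> {1..n} \<Longrightarrow> j \<in> {1..n} \<Longrightarrow> E i * P j = (if i = j then P j else 0)"
    by (rule complete_imp_dual_idempotents[OF compl]) blast
  have adjP: "adj (P i) = P i" if "i \<in> {1..n}" for i
    using compl that
    by (auto simp: complete_projections_def nontrivial_projection_def projection_def)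
  let ?A = "\<Sum>i=1..n. P i"
  \<comment> \<open>Once \<open>P i * B = E i\<close> is known, this reads
    \<open>B = B * ?A * B\<close>, expanded over the projections.\<close>
  define B where "B = (\<Sum>i=1..n. adj (E i) * E i)"
  have PB: "P i * B = E i" if i: "i \<in> {1..n}" for i
  proof -
    have "P i * (adj (E k) * E k) = (if k = i then E i else 0)" if k: "k \<in> {1..n}" for k
    proof -
      have "P i * adj (E k) = adj (E k * P i)" by (simp add: adj_mult adjP[OF i])
      also have "\<dots> = (if k = i then P i else 0)" by (simp add: EP[OF k i] adjP[OF i])
      finally show ?thesis using PE[OF i] by (simp flip: mult.assoc)
    qed
    then have "P i * B = (\<Sum>k=1..n. if k = i then E i else 0)"
      unfolding B_def sum_distrib_left by (intro sum.cong) simp_all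
    then show ?thesis using i by simp
  qed
  have AB: "?A * B = 1"
    unfolding sum_distrib_right E1[symmetric] by (rule sum.cong[OF refl PB])
  have "adj B = B" by (simp add: B_def adj_sum adj_mult adj_adj)
  moreover have "adj ?A = ?A" unfolding adj_sum by (rule sum.cong[OF refl adjP])
  \<comment> \<open>Taking adjoints turns the right inverse into a left one.\<close>
  ultimately have BA: "B * ?A = 1" using arg_cong[OF AB, of adj] by (simp add: adj_mult)
  show thesis
  proof (rule that)
    show "is_alg_inverse ?A B" using AB BA by (simp add: is_alg_inverse_def)
    show "P i * B * P j = 0" if "i \<in> {1..n}" "j \<in> {1..n}" "i \<noteq> j" for i j
      using that by (simp add: PB EP)
  qed
qed

section \<open>Independence of the ranges by diagonal dominance\<close>

lemma sum_in_ranges_eq_0_imp: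
  fixes P :: "'i \<Rightarrow> 'a::unital_cstar_algebra"
  assumes I: "finite I" "card I \<ge> 2"
    and proj: "\<And>i. i \<in> I \<Longrightarrow> projection (P i)"
    and inv: "is_alg_inverse (sum P I) B"
    and small: "\<And>i j. i \<in> I \<Longrightarrow> j \<in> I \<Longrightarrow> i \<noteq> j \<Longrightarrow>
      norm (P i * B * P j) < inverse ((real (card I) - 1) * norm B * (norm (sum P I))\<^sup>2)"
    and z: "\<And>i. i \<in> I \<Longrightarrow> P i * z i = z i" "(\<Sum>i\<in>I. z i) = 0"
    and k: "k \<in> I"
  shows "z k = 0"
proof (rule ccontr)
  assume "z k \<noteq> 0"
  let ?A = "sum P I"
  define c where "c = inverse ((real (card I) - 1) * norm B * (norm ?A)\<^sup>2)"
  have A1: "1 \<le> norm ?A * norm B"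
    using inv norm_mult_ineq[of ?A B] by (simp add: is_alg_inverse_def)
  then have "?A \<noteq> 0" by auto
  then have A0: "norm ?A > 0" by simp
  \<comment> \<open>A whole row of off-diagonal bounds stays below the diagonal bound
    \<open>inverse (norm ?A)\<close>, because \<open>1 \<le> norm ?A * norm B\<close>.\<close>
  have cle: "(real (card I) - 1) * c \<le> inverse (norm ?A)"
  proof -
    have "real (card I) - 1 \<noteq> 0" using I(2) by simp
    then have "(real (card I) - 1) * c = inverse (norm ?A) * inverse (norm ?A * norm B)"
      by (simp add: c_def power2_eq_square mult_ac)
    also have "\<dots> \<le> inverse (norm ?A) * 1"
      using A0 le_imp_inverse_le[OF A1] by (intro mult_left_mono) simp_all
    finally show ?thesis by simp
  qed
  \<comment> \<open>As for diagonally dominant matrices, the row of a component of largest norm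
    gives the contradiction.\<close>
  obtain i where i: "i \<in> I" and max: "\<And>j. j \<in> I \<Longrightarrow> norm (z j) \<le> norm (z i)"
  proof -
    have "I \<noteq> {}" using k by auto
    with I(1) obtain i where "i \<in> I" and eq: "(MAX j\<in>I. norm (z j)) = norm (z i)"
      by (rule obtains_MAX[where f = "\<lambda>j. norm (z j)"])
    have "norm (z j) \<le> norm (z i)" if "j \<in> I" for j
      unfolding eq[symmetric] using I(1) that by (intro Max_ge) auto
    with \<open>i \<in> I\<close> show thesis by (rule that)
  qed
  have zi: "norm (z i) > 0" using max[OF k] \<open>z k \<noteq> 0\<close> by (metis norm_le_zero_iff not_le order_trans)
  obtain s where s: "adj s = s" "s * s = ?A"
    using proj by (rule self_adjoint_sqrt_sum_projections)
  \<comment> \<open>This puts \<open>P i\<close> in front of \<open>B\<close>, so the quadratic form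
    bounds \<open>P i * B * z i\<close> from below.\<close>
  have "adj (z i) = adj (z i) * P i"
    using arg_cong[OF z(1)[OF i], of adj] proj[OF i] by (simp add: adj_mult projection_def)
  then have "adj (z i) * B * z i = adj (z i) * (P i * B * z i)"
    by (simp add: mult.assoc) (metis mult.assoc)
  then have "(norm (z i))\<^sup>2 \<le> norm ?A * (norm (z i) * norm (P i * B * z i))"
    using norm_square_le_inverse_form[OF s(1), of B "z i"] inv s(2) A0
      norm_mult_ineq[of "adj (z i)" "P i * B * z i"]
    by (smt (verit) mult_le_cancel_left_pos norm_adj)
  then have lower: "norm (z i) \<le> norm ?A * norm (P i * B * z i)"
    using zi by (simp add: power2_eq_square mult.left_commute[of "norm ?A"])
  have "P i * B * z i + (\<Sum>j\<in>I - {i}. P i * B * z j) = P i * B * (\<Sum>j\<in>I. z j)"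
    unfolding sum_distrib_left using I(1) i by (rule sum.remove[symmetric])
  then have "P i * B * z i = - (\<Sum>j\<in>I - {i}. P i * B * z j)"
    using z(2) by (simp add: eq_neg_iff_add_eq_0)
  then have "norm (P i * B * z i) \<le> (\<Sum>j\<in>I - {i}. norm (P i * B * z j))"
    by (simp add: norm_sum)
  also have "\<dots> < (\<Sum>j\<in>I - {i}. c * norm (z i))"
  \<comment> \<open>Strictness needs a second index, supplied by
    \<open>card I \<ge> 2\<close>.\<close>
  proof (rule sum_strict_mono)
    show "finite (I - {i})" using I by simp
    show "I - {i} \<noteq> {}"
    proof
      assume "I - {i} = {}"
      then have "card I \<le> card {i}" by (intro card_mono) auto
      with I(2) show False by simp
    qed
    fix j assume j: "j \<in> I - {i}"
    have "norm (P i * B * z j) = norm (P i * B * P j * z j)"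
      using z(1)[of j] j by (simp add: mult.assoc)
    also have "\<dots> \<le> norm (P i * B * P j) * norm (z j)" by (rule norm_mult_ineq)
    also have "\<dots> \<le> norm (P i * B * P j) * norm (z i)"
      using max j by (intro mult_left_mono) auto
    also have "\<dots> < c * norm (z i)"
      using small[OF i, of j] j zi by (intro mult_strict_right_mono) (auto simp: c_def)
    finally show "norm (P i * B * z j) < c * norm (z i)" .
  qed
  also have "\<dots> = (real (card I) - 1) * c * norm (z i)"
    using I i by (simp add: of_nat_diff)
  also have "\<dots> \<le> inverse (norm ?A) * norm (z i)"
    using cle by (rule mult_right_mono) simp
  finally have "norm ?A * norm (P i * B * z i) < norm (z i)"
    using A0 by (simp add: field_simps)
  with lower show False by simp
qed

section \<open>The two implications of the criterion\<close>

theorem theorem3p10: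
  fixes P :: "nat \<Rightarrow> 'a::unital_cstar_algebra" and n :: nat and A :: 'a
  assumes "n \<ge> 2"
    and "\<And>i. i \<in> {1..n} \<Longrightarrow> nontrivial_projection (P i)"
    and "A = (\<Sum>i=1..n. P i)"
  shows "complete_projections n P \<longleftrightarrow>
    alg_invertible A \<and>
    (\<forall>i\<in>{1..n}. \<forall>j\<in>{1..n}. i \<noteq> j \<longrightarrow>
       norm (P i * alg_inverse A * P j)
         < inverse ((real n - 1) * norm (alg_inverse A) * (norm A)\<^sup>2))"
    (is "_ \<longleftrightarrow> _ \<and> ?small")
proof (intro iffI conjI)
  assume "complete_projections n P"
  then obtain B where B: "is_alg_inverse A B"
    and PBP: "\<And>i j. i \<in> {1..n} \<Longrightarrow> j \<in> {1..n} \<Longrightarrow> i \<noteq> j \<Longrightarrow> P i * B * P j = 0"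
    unfolding assms(3) by (rule complete_imp_inverse_sum) blast
  show "alg_invertible A" using B by (auto simp: alg_invertible_def)
  \<comment> \<open>The off-diagonal blocks vanish, so it suffices that the bound is positive;
    \<open>n \<ge> 2\<close> enters here.\<close>
  have "A \<noteq> 0" "B \<noteq> 0" using B by (auto simp: is_alg_inverse_def)
  then have "inverse ((real n - 1) * norm B * (norm A)\<^sup>2) > 0"
    using assms(1) by simp
  then show ?small by (simp add: alg_inverse_eq[OF B] PBP)
next
  assume *: "alg_invertible A \<and> ?small"
  then obtain B where B: "is_alg_inverse A B" by (auto simp: alg_invertible_def)
  have small: "norm (P i * B * P j) < inverse ((real n - 1) * norm B * (norm A)\<^sup>2)"
    if "i \<in> {1..n}" "j \<in> {1..n}" "i \<noteq> j" for i j
    using * that by (simp add: alg_inverse_eq[OF B])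
  have proj: "projection (P i)" if "i \<in> {1..n}" for i
    using assms(2)[OF that] by (simp add: nontrivial_projection_def)
  let ?X = "\<Pi>\<^sub>E i\<in>{1..n}. {P i * y | y. True}"
  have fixed: "P i * x i = x i" if "x \<in> ?X" "i \<in> {1..n}" for x i
  proof -
    obtain y where "x i = P i * y" using \<open>x \<in> ?X\<close> \<open>i \<in> {1..n}\<close> by fastforce
    then show ?thesis using proj[OF \<open>i \<in> {1..n}\<close>] by (metis mult.assoc projection_def)
  qed
  have "\<exists>!x. x \<in> ?X \<and> a = (\<Sum>i=1..n. x i)" for a
  proof (rule ex_ex1I)
    \<comment> \<open>Expand \<open>a = A * (B * a)\<close> over the projections.\<close>
    let ?x = "restrict (\<lambda>i. P i * (B * a)) {1..n}"
    have "(\<Sum>i=1..n. ?x i) = A * (B * a)"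
      unfolding assms(3) sum_distrib_right by (rule sum.cong) simp_all
    also have "\<dots> = a" using B by (simp add: is_alg_inverse_def flip: mult.assoc)
    finally have "a = (\<Sum>i=1..n. ?x i)" ..
    moreover have "?x \<in> ?X" by auto
    ultimately show "\<exists>x. x \<in> ?X \<and> a = (\<Sum>i=1..n. x i)" by blast
  next
    fix x y
    assume x: "x \<in> ?X \<and> a = (\<Sum>i=1..n. x i)" and y: "y \<in> ?X \<and> a = (\<Sum>i=1..n. y i)"
    show "x = y"
    proof (rule PiE_ext)
      show "x \<in> ?X" "y \<in> ?X" using x y by auto
      fix k assume "k \<in> {1..n}"
      \<comment> \<open>The difference of two decompositions of \<open>a\<close> is a vanishing sum
        with terms in the ranges.\<close>
      then have "x k - y k = 0"
      proof (rule sum_in_ranges_eq_0_imp[rotated -1])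
        show "is_alg_inverse (sum P {1..n}) B" using B assms(3) by simp
        show "(\<Sum>i=1..n. x i - y i) = 0" using x y by (simp add: sum_subtractf)
        show "P i * (x i - y i) = x i - y i" if "i \<in> {1..n}" for i
          using fixed[of x i] fixed[of y i] x y that by (simp add: right_diff_distrib)
      qed (use assms small proj in auto)
      then show "x k = y k" by simp
    qed
  qed
  then show "complete_projections n P"
    using assms(2) by (simp add: complete_projections_def)
qed

end
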